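(* Let $M$ be a compact connected metric space and let $A:M\times M\to\mathbb{R}$ be a continuous function such that the associated real number $l$ (the asymptotic growth rate of the functions $A_n$) equals $0$. Let $c(x,y)=\liminf_{n\to\infty}A_n(x,y)$ and $D=\{(x,y)\in M\times M: A(x,y)+c(y,x)=0\}$. Then $$\min_{\eta}\int_{M\times M}A(x,y)\,d\eta(x,y)=0,$$ where the minimum is taken over the set of Borel probability measures $\eta$ on $M\times M$ such that $\pi_{0\sharp}(\eta)=\pi_{1\sharp}(\eta)$. Among these measures, the minimizing ones are exactly those which are supported on $D$.
   Context: Set $A_1=A$ and, for $n\geq 2$, $A_n(x,y)=\min_{z_1,\ldots,z_{n-1}\in M}\big(A(x,z_1)+A(z_1,z_2)+\cdots+A(z_{n-1},y)\big)$. For any continuous $A$ on $M\times M$ the functions $A_n$ are equicontinuous and there are a (unique) real number $l$ and a positive constant $C$ such that $|A_n(x,y)-ln|\leq C$ for all $n\geq 1$ and all $x,y\in M$. When $l=0$ the function $c$ is finite and continuous on $M\times M$ (so $D$ is closed). $\pi_0,\pi_1:M\times M\to M$ are the projections on the first and second factor, and $\pi_{i\sharp}(\eta)$ denotes the push-forward of $\eta$ by $\pi_i$. *)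

theory Defs
  imports "HOL-Probability.Probability"
begin

text \<open>
  The space is the carrier of a type of class \<^class>\<open>metric_space\<close> (hence nonempty); compactness and
  connectedness are hypotheses on \<^term>\<open>UNIV\<close>.
\<close>

text \<open>
  For \<open>n \<ge> 1\<close> the intermediate points are \<open>z 1, ..., z (n - 1)\<close>; the values \<open>z i\<close> with \<open>i > n\<close> are
  irrelevant. For continuous \<open>A\<close> on a compact space the infimum is a minimum. In particular
  \<open>iter_cost A 1 x y = A (x, y)\<close>; the value at \<open>n = 0\<close> is junk and plays no role.
\<close>
definition iter_cost :: "('a \<times> 'a \<Rightarrow> real) \<Rightarrow> nat \<Rightarrow> 'a \<Rightarrow> 'a \<Rightarrow> real" where
  "iter_cost A n x y = (INF z\<in>{z :: nat \<Rightarrow> 'a. z 0 = x \<and> z n = y}. \<Sum>i<n. A (z i, z (Suc i)))"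

text \<open>The description is proper (existence and uniqueness) for continuous \<open>A\<close> on a compact space.\<close>
definition growth_rate :: "('a \<times> 'a \<Rightarrow> real) \<Rightarrow> real" where
  "growth_rate A =
    (THE l. \<exists>C>0. \<forall>n\<ge>1. \<forall>x y. \<bar>iter_cost A n x y - l * real n\<bar> \<le> C)"

definition liminf_cost :: "('a \<times> 'a \<Rightarrow> real) \<Rightarrow> 'a \<Rightarrow> 'a \<Rightarrow> ereal" where
  "liminf_cost A x y = liminf (\<lambda>n. ereal (iter_cost A n x y))"

definition calibrated_set :: "('a \<times> 'a \<Rightarrow> real) \<Rightarrow> ('a \<times> 'a) set" where
  "calibrated_set A = {(x, y). ereal (A (x, y)) + liminf_cost A y x = 0}"

definition equal_marginal_measures :: "('a::topological_space \<times> 'a) measure set" where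
  "equal_marginal_measures =
    {\<eta>. prob_space \<eta> \<and> sets \<eta> = sets borel \<and> distr \<eta> borel fst = distr \<eta> borel snd}"

definition measure_support :: "'b::topological_space measure \<Rightarrow> 'b set" where
  "measure_support \<mu> = {p. \<forall>U. open U \<and> p \<in> U \<longrightarrow> emeasure \<mu> U > 0}"

end

(*
A continuous u with u(y) - u(x) <= A(x,y) for all x, y (a subaction) gives int A >= 0 for every
measure with equal marginals, because the coboundary u(y) - u(x) integrates to zero; moreover
int A = 0 holds iff A(x,y) = u(y) - u(x) on the support. The subaction u = c(p, .) gives
nonnegativity, and by the triangle inequality for c it is an equality on D, so measures supported
on D minimize. Conversely, on the support of a minimizing measure the subaction
u = inf_n A_n(x, .) forces inf_n A_n(x,x) = 0, hence c(x,x) = 0, and then the subaction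
u = -c(., x) yields A(x,y) + c(y,x) = 0.

A minimizing measure is a weak limit of empirical measures of nearly optimal closed paths, whose
total cost stays bounded. Weak compactness is reduced to Helly's theorem on the real line: a compact
metric space is the continuous image of a compact subset of the Cantor set.
*)
theory Submission
  imports Defs
begin

section \<open>Weak limits of empirical measures on a compact metric space\<close>

text \<open>The range is the Cantor set scaled by 3/2. With digits 0 and 1, base 3 leaves no double
  expansions, so the code is injective, as it would not be in base 2.\<close>

definition ternary_code :: "(nat \<Rightarrow> bool) \<Rightarrow> real" where
  "ternary_code b = (\<Sum>k. of_bool (b k) * (1/3) ^ k)"

lemma summable_ternary: "summable (\<lambda>k. of_bool (b k) * (1/3) ^ k :: real)"
  by (rule summable_comparison_test'[of "\<lambda>k. (1/3) ^ k" 0]) (simp_all add: of_bool_def)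

text \<open>The first differing digit decides: it contributes 3^(-k), and all later digits together
  can take back at most 3^(-k)/2.\<close>

lemma ternary_code_less:
  assumes eq: "\<And>j. j < k \<Longrightarrow> b j = b' j" and b: "b k" and b': "\<not> b' k"
  shows "ternary_code b' < ternary_code b"
proof -
  define h :: "nat \<Rightarrow> real" where "h j = of_bool (b j) * (1/3) ^ j - of_bool (b' j) * (1/3) ^ j" for j
  have h: "summable h" and diff: "ternary_code b - ternary_code b' = suminf h"
    unfolding h_def ternary_code_def
    by (intro summable_diff summable_ternary suminf_diff)+
  have "(\<Sum>j<Suc k. h j) = (1/3) ^ k"
    using eq b b' by (simp add: h_def)
  with suminf_split_initial_segment[OF h, of "Suc k"]
  have 1: "suminf h = (\<Sum>j. h (j + Suc k)) + (1/3) ^ k" by metis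
  have tail: "summable (\<lambda>j. h (j + Suc k))"
    by (rule summable_ignore_initial_segment[OF h])
  have g: "(\<lambda>j. (1/3::real) ^ Suc k * (1/3) ^ j) sums ((1/3) ^ Suc k * (1 / (1 - 1/3)))"
    by (intro sums_mult geometric_sums) simp
  have 2: "(\<Sum>j. - h (j + Suc k)) \<le> (\<Sum>j. (1/3::real) ^ Suc k * (1/3) ^ j)"
  proof (rule suminf_le)
    show "summable (\<lambda>j. - h (j + Suc k))"
      by (rule summable_minus[OF tail])
    show "- h (j + Suc k) \<le> (1/3) ^ Suc k * (1/3) ^ j" for j
      by (simp add: h_def power_add)
    show "summable (\<lambda>j. (1/3::real) ^ Suc k * (1/3) ^ j)"
      by (rule sums_summable[OF g])
  qed
  have 3: "(\<Sum>j. (1/3::real) ^ Suc k * (1/3) ^ j) = (1/3) ^ k * (1/2)"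
    using sums_unique[OF g] by simp
  have "(1/3::real) ^ k > 0" by simp
  then have "suminf h > 0"
    using 1 2 3 suminf_minus[OF tail] by argo
  then show ?thesis using diff by simp
qed

lemma inj_ternary_code: "inj ternary_code"
proof (rule injI, rule ccontr)
  fix b b' assume eq: "ternary_code b = ternary_code b'" and "b \<noteq> b'"
  then have ex: "\<exists>k. b k \<noteq> b' k" by auto
  define k where "k = (LEAST k. b k \<noteq> b' k)"
  have k: "b k \<noteq> b' k" and j: "\<And>j. j < k \<Longrightarrow> b j = b' j"
    unfolding k_def using LeastI_ex[OF ex] not_less_Least by auto
  show False
    using ternary_code_less[of k b b'] ternary_code_less[of k b' b] k j eq by (cases "b k") auto
qed

lemma continuous_on_of_bool_coordinate:
  "continuous_on UNIV (\<lambda>b :: nat \<Rightarrow> bool. of_bool (b k) :: real)"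
proof (rule continuous_on_compose2[of UNIV of_bool UNIV "\<lambda>b. b k"])
  show "continuous_on UNIV (of_bool :: bool \<Rightarrow> real)"
    by (simp add: continuous_on_def at_discrete)
  show "continuous_on UNIV (\<lambda>b :: nat \<Rightarrow> bool. b k)"
    by (rule continuous_on_product_then_coordinatewise[OF continuous_on_id])
qed simp

lemma continuous_on_ternary_code: "continuous_on UNIV ternary_code"
  unfolding ternary_code_def
proof (rule uniform_limit_theorem)
  show "uniform_limit UNIV (\<lambda>n b. \<Sum>k<n. of_bool (b k) * (1/3) ^ k :: real)
          (\<lambda>b. \<Sum>k. of_bool (b k) * (1/3) ^ k) sequentially"
    by (rule Weierstrass_m_test[of _ _ "\<lambda>k. (1/3) ^ k"]) (auto intro!: summable_geometric)
qed (intro always_eventually allI continuous_intros continuous_on_of_bool_coordinate, simp)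

lemma compact_UNIV_bool_seq: "compact (UNIV :: (nat \<Rightarrow> bool) set)"
proof -
  have "compact_space (product_topology (\<lambda>_::nat. euclidean :: bool topology) UNIV)"
    unfolding compact_space_product_topology
    by (simp add: compact_space_def finite_imp_compact)
  then show ?thesis
    by (simp add: compact_space_def euclidean_product_topology)
qed

section \<open>A compact metric space as continuous image of a compact set of reals\<close>

text \<open>Total boundedness gives a finite 1/(j+1)-net for each j. The balls of that radius about
  the net points form a countable family, and once the radius is below half of
  \<open>dist x y\<close>, a ball containing \<open>x\<close> leaves \<open>y\<close> strictly
  outside.\<close>

lemma countable_separating_balls:
  assumes "compact (UNIV :: 'a::metric_space set)"
  obtains s :: "nat \<Rightarrow> 'a::metric_space" and r :: "nat \<Rightarrow> real"
    where "\<And>x y. x \<noteq> y \<Longrightarrow> \<exists>k. dist x (s k) < r k \<and> r k < dist y (s k)"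
proof -
  have "\<exists>k. finite k \<and> (UNIV :: 'a set) \<subseteq> (\<Union>x\<in>k. ball x (1 / real (Suc j)))" for j
    using seq_compact_imp_totally_bounded[OF compact_imp_seq_compact[OF assms]] by auto
  then obtain N :: "nat \<Rightarrow> 'a set"
    where N: "\<And>j. finite (N j)" "\<And>j. UNIV \<subseteq> (\<Union>x\<in>N j. ball x (1 / real (Suc j)))"
    by metis
  define F where "F = (\<Union>j. N j \<times> {1 / real (Suc j)})"
  have "countable F"
    unfolding F_def using N(1) by (auto intro: countable_finite)
  have cover: "\<exists>s\<in>N j. dist x s < 1 / real (Suc j)" for x j
    using N(2)[of j] by (force simp: dist_commute)
  then have "F \<noteq> {}" by (fastforce simp: F_def)
  show thesis
  proof (rule that[of "\<lambda>k. fst (from_nat_into F k)" "\<lambda>k. snd (from_nat_into F k)"])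
    fix x y :: 'a assume "x \<noteq> y"
    then obtain j where j: "1 / real (Suc j) < dist x y / 2"
      using reals_Archimedean[of "dist x y / 2"] by (auto simp: inverse_eq_divide)
    obtain s where s: "s \<in> N j" "dist x s < 1 / real (Suc j)" using cover by blast
    then have "(s, 1 / real (Suc j)) \<in> F" by (auto simp: F_def)
    then obtain k where k: "from_nat_into F k = (s, 1 / real (Suc j))"
      using \<open>countable F\<close> by (metis from_nat_into_surj)
    have "1 / real (Suc j) < dist y s"
      using dist_triangle[of x y s] j s by (simp add: dist_commute)
    then show "\<exists>k. dist x (fst (from_nat_into F k)) < snd (from_nat_into F k) \<and>
            snd (from_nat_into F k) < dist y (fst (from_nat_into F k))"
      using k s by (intro exI[of _ k]) simp
  qed
qed

text \<open>Pair each point with its codes to get a compact set \<Gamma>. The code alone determines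
  the pair, so \<open>e\<close> embeds \<Gamma> into the reals; the inverse of \<open>e\<close> is
  continuous by compactness, and \<open>g\<close> is this inverse followed by the first
  projection.\<close>

lemma compact_metric_image_of_real_compact:
  assumes X: "compact (UNIV :: 'a::metric_space set)"
  obtains K :: "real set" and g :: "real \<Rightarrow> 'a::metric_space"
    where "compact K" "continuous_on K g" "g ` K = UNIV"
proof -
  obtain s :: "nat \<Rightarrow> 'a" and r :: "nat \<Rightarrow> real"
    where sep: "\<And>x y. x \<noteq> y \<Longrightarrow> \<exists>k. dist x (s k) < r k \<and> r k < dist y (s k)"
    using countable_separating_balls[OF X] by blast
  \<comment> \<open>\<open>b k\<close> records on which side of the \<open>k\<close>-th sphere \<open>x\<close> lies; points on the sphere keep both
    codes, which makes \<open>\<Gamma>\<close> closed, and \<open>b\<close> still determines \<open>x\<close>.\<close>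
  define \<Gamma> :: "('a \<times> (nat \<Rightarrow> bool)) set" where
    "\<Gamma> = (\<Inter>k. {p. (2 * of_bool (snd p k) - 1) * (dist (fst p) (s k) - r k) \<le> 0})"
  have "continuous_on UNIV (\<lambda>p :: 'a \<times> (nat \<Rightarrow> bool). of_bool (snd p k) :: real)" for k
    by (rule continuous_on_compose2[OF continuous_on_of_bool_coordinate continuous_on_snd[OF continuous_on_id]]) auto
  then have "closed \<Gamma>"
    unfolding \<Gamma>_def by (intro closed_INT ballI closed_Collect_le continuous_intros)
  then have \<Gamma>: "compact \<Gamma>"
    using compact_Times[OF X compact_UNIV_bool_seq] compact_Int_closed[of UNIV \<Gamma>] by simp
  have \<Gamma>_iff: "(x, b) \<in> \<Gamma> \<longleftrightarrow> (\<forall>k. if b k then dist x (s k) \<le> r k else r k \<le> dist x (s k))" for x b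
    by (auto simp: \<Gamma>_def of_bool_def)
  define e where "e p = ternary_code (snd p)" for p :: "'a \<times> (nat \<Rightarrow> bool)"
  have e: "continuous_on \<Gamma> e"
    unfolding e_def
    by (rule continuous_on_compose2[OF continuous_on_ternary_code continuous_on_snd[OF continuous_on_id]]) auto
  have inj: "inj_on e \<Gamma>"
  proof (rule inj_onI)
    fix p q assume p: "p \<in> \<Gamma>" and q: "q \<in> \<Gamma>" and "e p = e q"
    then have snd: "snd p = snd q" using inj_ternary_code by (auto simp: e_def inj_eq)
    obtain x y b where xy: "p = (x, b)" "q = (y, b)" using snd by (metis prod.collapse)
    show "p = q"
    proof (rule ccontr)
      assume "p \<noteq> q"
      then obtain k where "dist x (s k) < r k \<and> r k < dist y (s k)" using sep xy by blast
      then show False using p q by (auto simp: xy \<Gamma>_iff) (metis leD)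
    qed
  qed
  show thesis
  proof (rule that[of "e ` \<Gamma>" "\<lambda>t. fst (the_inv_into \<Gamma> e t)"])
    show "compact (e ` \<Gamma>)" using e \<Gamma> by (rule compact_continuous_image)
    show "continuous_on (e ` \<Gamma>) (\<lambda>t. fst (the_inv_into \<Gamma> e t))"
      using continuous_on_inv_into[OF e \<Gamma> inj] by (intro continuous_intros)
    have "x \<in> (\<lambda>t. fst (the_inv_into \<Gamma> e t)) ` e ` \<Gamma>" for x
    proof -
      \<comment> \<open>Every point has at least one admissible code, which makes \<open>g\<close>
        surjective.\<close>
      have "(x, \<lambda>k. dist x (s k) \<le> r k) \<in> \<Gamma>" by (simp add: \<Gamma>_iff)
      then show ?thesis
        using the_inv_into_f_f[OF inj] by (force simp: image_iff)
    qed
    then show "(\<lambda>t. fst (the_inv_into \<Gamma> e t)) ` e ` \<Gamma> = UNIV" by auto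
  qed
qed

section \<open>Weak limits, and measures determined by continuous functions\<close>

text \<open>Measures living on one compact set are tight, so Helly's theorem applies. The indicator
  factors let the test functions be continuous on \<open>K\<close> only.\<close>

lemma weakly_convergent_subseq_on_compact:
  fixes \<nu> :: "nat \<Rightarrow> real measure"
  assumes K: "compact K" and \<nu>: "\<And>n. real_distribution (\<nu> n)" and \<nu>K: "\<And>n. AE t in \<nu> n. t \<in> K"
  obtains r N where "strict_mono (r :: nat \<Rightarrow> nat)" "real_distribution N" "AE t in N. t \<in> K"
    "\<And>f :: real \<Rightarrow> real. continuous_on K f \<Longrightarrow>
       (\<lambda>n. \<integral>t. indicator K t * f t \<partial>\<nu> (r n)) \<longlonglongrightarrow> (\<integral>t. indicator K t * f t \<partial>N)"
proof -
  have ne: "K \<noteq> {}"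
  proof
    interpret real_distribution "\<nu> 0" by (rule \<nu>)
    assume "K = {}"
    then show False using \<nu>K[of 0] by simp
  qed
  obtain B where B: "\<And>t. t \<in> K \<Longrightarrow> \<bar>t\<bar> \<le> B" "B > 0"
    using compact_imp_bounded[OF K] unfolding bounded_pos by auto
  have "tight \<nu>"
    unfolding tight_def
  proof (intro conjI allI impI \<nu>)
    fix e :: real assume e: "e > 0"
    \<comment> \<open>\<open>tight\<close> uses half-open intervals, so the left end is moved by 1
      to keep the point \<open>-B\<close> inside.\<close>
    have "measure (\<nu> n) {-B-1<..B} > 1 - e" for n
    proof -
      interpret real_distribution "\<nu> n" by (rule \<nu>)
      have "AE t in \<nu> n. t \<in> {-B-1<..B}"
        using \<nu>K[of n] by eventually_elim (use B in force)
      then have "prob {-B-1<..B} = 1" by (intro prob_eq_1[THEN iffD2]) auto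
      then show ?thesis using e by simp
    qed
    then show "\<exists>a b. a < b \<and> (\<forall>n. measure (\<nu> n) {a<..b} > 1 - e)"
      using B(2) by (intro exI[of _ "-B-1"] exI[of _ B]) auto
  qed
  from tight_imp_convergent_subsubsequence[OF this, of id]
  obtain r N where r: "strict_mono r" and N: "real_distribution N" and conv: "weak_conv_m (\<nu> \<circ> r) N"
    by (metis comp_id fun.map_id strict_mono_id)
  interpret N: real_distribution N by (rule N)
  have lim: "(\<lambda>n. integral\<^sup>L (\<nu> (r n)) F) \<longlonglongrightarrow> integral\<^sup>L N F"
    if "continuous_on UNIV F" "\<And>t. \<bar>F t\<bar> \<le> C" for F :: "real \<Rightarrow> real" and C
  proof -
    have "isCont F t" for t using that(1) by (simp add: continuous_on_eq_continuous_at)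
    then show ?thesis
      using weak_conv_imp_integral_bdd_continuous_conv[of "\<nu> \<circ> r" N F C] that(2) \<nu> N conv
      by (simp add: o_def)
  qed
  have NK: "AE t in N. t \<in> K"
  proof -
    \<comment> \<open>A bounded continuous function vanishing exactly on \<open>K\<close>: its
      integrals against the sequence are 0, hence so is the one against \<open>N\<close>, which
      places \<open>N\<close> on \<open>K\<close>.\<close>
    let ?d = "\<lambda>t. min 1 (infdist t K)"
    have meas: "?d \<in> borel_measurable borel"
      by (intro borel_measurable_continuous_onI continuous_intros)
    have "(\<integral>t. ?d t \<partial>\<nu> (r n)) = 0" for n
      using \<nu>K[of "r n"] by (intro integral_eq_zero_AE) (auto elim!: eventually_mono)
    moreover have "(\<lambda>n. \<integral>t. ?d t \<partial>\<nu> (r n)) \<longlonglongrightarrow> (\<integral>t. ?d t \<partial>N)"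
      by (rule lim[of _ 1]) (auto intro!: continuous_intros simp: infdist_nonneg)
    ultimately have "(\<integral>t. ?d t \<partial>N) = 0"
      by (simp add: LIMSEQ_const_iff)
    moreover have "integrable N ?d"
      by (rule N.integrable_const_bound[of _ 1]) (use meas in \<open>auto simp: infdist_nonneg\<close>)
    ultimately have "AE t in N. ?d t = 0"
      by (subst (asm) integral_nonneg_eq_0_iff_AE) (auto simp: infdist_nonneg)
    then show ?thesis
    proof eventually_elim
      case (elim t)
      then have "infdist t K = 0" by linarith
      then show ?case using in_closed_iff_infdist_zero[OF compact_imp_closed[OF K] ne] by blast
    qed
  qed
  show thesis
  proof (rule that[OF r N NK])
    fix f :: "real \<Rightarrow> real" assume f: "continuous_on K f"
    obtain C where C: "C > 0" "\<And>t. t \<in> K \<Longrightarrow> norm (f t) \<le> C"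
      using compact_imp_bounded[OF compact_continuous_image[OF f K]] unfolding bounded_pos by auto
    \<comment> \<open>The convergence \<open>lim\<close> is for bounded continuous functions on the
      whole line, so \<open>f\<close> is extended by Tietze with the same bound
      \<open>C\<close>.\<close>
    obtain F where F: "continuous_on UNIV F" "\<And>t. t \<in> K \<Longrightarrow> F t = f t" "\<And>t. t \<in> UNIV \<Longrightarrow> norm (F t) \<le> C"
      using Tietze[OF f, of UNIV C] C compact_imp_closed[OF K] by auto
    have "(\<integral>t. indicator K t * f t \<partial>L) = integral\<^sup>L L F"
      if "AE t in L. t \<in> K" "sets L = sets borel" for L
    proof -
      have [measurable]: "F \<in> borel_measurable L" "K \<in> sets L"
        using F(1) K that(2) measurable_cong_sets[OF that(2) refl]
        by (auto intro: borel_measurable_continuous_onI borel_compact)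
      have "(\<integral>t. indicator K t * f t \<partial>L) = (\<integral>t. indicator K t * F t \<partial>L)"
        using F(2) by (intro Bochner_Integration.integral_cong) (auto simp: indicator_def)
      also have "\<dots> = integral\<^sup>L L F"
        using that(1) by (intro integral_cong_AE) (auto elim!: eventually_mono)
      finally show ?thesis .
    qed
    then show "(\<lambda>n. \<integral>t. indicator K t * f t \<partial>\<nu> (r n)) \<longlonglongrightarrow> (\<integral>t. indicator K t * f t \<partial>N)"
      using lim[OF F(1), of C] F(3) NK N.events_eq_borel \<nu>K real_distribution.events_eq_borel[OF \<nu>] by simp
  qed
qed

text \<open>The sample points are lifted along \<open>g\<close> to \<open>K\<close>, the lifted
  empirical measures converge along a subsequence, and the limit is pushed forward by
  \<open>g\<close>.\<close>

lemma empirical_measures_weakly_convergent_subseq: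
  fixes p :: "nat \<Rightarrow> nat \<Rightarrow> 'a::metric_space" and m :: "nat \<Rightarrow> nat"
  assumes X: "compact (UNIV :: 'a set)" and m: "\<And>n. m n > 0"
  obtains r \<mu> where "strict_mono (r :: nat \<Rightarrow> nat)" "prob_space \<mu>" "sets \<mu> = sets borel"
    "\<And>f :: 'a \<Rightarrow> real. continuous_on UNIV f \<Longrightarrow>
       (\<lambda>n. (\<Sum>i<m (r n). f (p (r n) i)) / real (m (r n))) \<longlonglongrightarrow> integral\<^sup>L \<mu> f"
proof -
  obtain K :: "real set" and g :: "real \<Rightarrow> 'a" where K: "compact K" "continuous_on K g" "g ` K = UNIV"
    using compact_metric_image_of_real_compact[OF X] by blast
  \<comment> \<open>Any choice of preimages is measurable, since the indices carry the full
    sigma-algebra of a pmf.\<close>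
  define q where "q n i = (SOME t. t \<in> K \<and> g t = p n i)" for n i
  have q: "q n i \<in> K" "g (q n i) = p n i" for n i
  proof -
    have "\<exists>t. t \<in> K \<and> g t = p n i" using K(3) by (metis UNIV_I imageE)
    from someI_ex[OF this] show "q n i \<in> K" "g (q n i) = p n i" by (auto simp: q_def)
  qed
  define U where "U n = pmf_of_set {..<m n}" for n
  have U: "set_pmf (U n) = {..<m n}" for n
    unfolding U_def using m[of n] by (intro set_pmf_of_set) auto
  define \<nu> where "\<nu> n = distr (measure_pmf (U n)) borel (q n)" for n
  have \<nu>: "real_distribution (\<nu> n)" for n
    unfolding \<nu>_def by (intro prob_space.real_distribution_distr prob_space_measure_pmf) simp
  have \<nu>K: "AE t in \<nu> n. t \<in> K" for n
    unfolding \<nu>_def using q K(1) by (subst AE_distr_iff) (auto intro: borel_compact)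
  obtain r N where r: "strict_mono r" and N: "real_distribution N" and NK: "AE t in N. t \<in> K"
    and lim: "\<And>f :: real \<Rightarrow> real. continuous_on K f \<Longrightarrow>
       (\<lambda>n. \<integral>t. indicator K t * f t \<partial>\<nu> (r n)) \<longlonglongrightarrow> (\<integral>t. indicator K t * f t \<partial>N)"
    using weakly_convergent_subseq_on_compact[of K \<nu>, OF K(1) \<nu> \<nu>K] by blast
  interpret N: real_distribution N by (rule N)
  \<comment> \<open>\<open>g\<close> is known to be continuous only on \<open>K\<close>; a constant
    value off \<open>K\<close> makes it Borel on the line, and \<open>N\<close> does not charge the
    complement.\<close>
  define g' where "g' t = (if t \<in> K then g t else g 0)" for t
  have g': "g' \<in> borel_measurable N"
    unfolding g'_def using K
    by (subst measurable_cong_sets[OF N.events_eq_borel refl],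
        intro borel_measurable_continuous_on_if) (auto intro: borel_compact continuous_intros)
  show thesis
  proof (rule that[OF r])
    show "prob_space (distr N borel g')" by (rule N.prob_space_distr[OF g'])
    fix f :: "'a \<Rightarrow> real" assume f: "continuous_on UNIV f"
    have fm: "f \<in> borel_measurable borel" using f by (rule borel_measurable_continuous_onI)
    have fg: "continuous_on K (\<lambda>t. f (g t))"
      using continuous_on_compose2[OF f K(2)] by simp
    have "(\<lambda>t. if t \<in> K then f (g t) else 0) \<in> borel_measurable borel"
      by (intro borel_measurable_continuous_on_if) (use fg K in \<open>auto intro: borel_compact\<close>)
    then have ind: "(\<lambda>t. indicator K t * f (g t)) \<in> borel_measurable borel"
      by (rule measurable_cong[THEN iffD1, rotated]) simp
    have "integral\<^sup>L (distr N borel g') f = (\<integral>t. f (g' t) \<partial>N)"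
      using fm g' by (rule integral_distr[rotated])
    also have "\<dots> = (\<integral>t. indicator K t * f (g t) \<partial>N)"
    proof (rule integral_cong_AE)
      show "AE t in N. f (g' t) = indicator K t * f (g t)"
        using NK by eventually_elim (simp add: g'_def)
      show "(\<lambda>t. f (g' t)) \<in> borel_measurable N"
        using measurable_compose[OF g' fm] .
      show "(\<lambda>t. indicator K t * f (g t)) \<in> borel_measurable N"
        using ind measurable_cong_sets[OF N.events_eq_borel refl] by blast
    qed
    finally have 1: "integral\<^sup>L (distr N borel g') f = (\<integral>t. indicator K t * f (g t) \<partial>N)" .
    have 2: "(\<integral>t. indicator K t * f (g t) \<partial>\<nu> n) = (\<Sum>i<m n. f (p n i)) / real (m n)" for n
    proof -
      have "(\<integral>t. indicator K t * f (g t) \<partial>\<nu> n) = (\<integral>i. f (p n i) \<partial>measure_pmf (U n))"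
        unfolding \<nu>_def using ind q by (subst integral_distr) auto
      also have "\<dots> = (\<Sum>i<m n. f (p n i)) / real (m n)"
        unfolding U_def using m[of n] by (subst integral_pmf_of_set) auto
      finally show ?thesis .
    qed
    show "(\<lambda>n. (\<Sum>i<m (r n). f (p (r n) i)) / real (m (r n))) \<longlonglongrightarrow> integral\<^sup>L (distr N borel g') f"
      using lim[OF fg] unfolding 1 2 .
  qed simp
qed

text \<open>The functions \<open>max 0 (1 - n * infdist x F)\<close> decrease to the indicator of a
  nonempty closed set \<open>F\<close>, so the measures agree on closed sets, which form an
  intersection-stable generator of the Borel sets.\<close>

lemma finite_borel_measure_eqI:
  fixes M N :: "'a::metric_space measure"
  assumes M: "finite_measure M" and N: "finite_measure N"
    and sM: "sets M = sets borel" and sN: "sets N = sets borel"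
    and eq: "\<And>f :: 'a \<Rightarrow> real. continuous_on UNIV f \<Longrightarrow> (\<And>x. 0 \<le> f x \<and> f x \<le> 1) \<Longrightarrow> integral\<^sup>L M f = integral\<^sup>L N f"
  shows "M = N"
proof -
  interpret M: finite_measure M by (rule M)
  interpret N: finite_measure N by (rule N)
  have lim: "(\<lambda>n. \<integral>x. max 0 (1 - real n * infdist x F) \<partial>L) \<longlonglongrightarrow> measure L F"
    if F: "closed F" "F \<noteq> {}" and L: "finite_measure L" "sets L = sets borel" for L and F :: "'a set"
  proof -
    interpret L: finite_measure L by (rule L)
    have "(\<lambda>n. \<integral>x. max 0 (1 - real n * infdist x F) \<partial>L) \<longlonglongrightarrow> (\<integral>x. indicator F x \<partial>L)"
    proof (rule integral_dominated_convergence[where w = "\<lambda>_. 1"])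
      show "(indicator F :: 'a \<Rightarrow> real) \<in> borel_measurable L"
        using F L(2) by (intro borel_measurable_indicator) auto
      show "(\<lambda>x. max 0 (1 - real n * infdist x F)) \<in> borel_measurable L" for n
        by (subst measurable_cong_sets[OF L(2) refl])
           (intro borel_measurable_continuous_onI continuous_intros)
      show "AE x in L. norm (max 0 (1 - real n * infdist x F)) \<le> 1" for n
        by (intro AE_I2) (auto simp: infdist_nonneg)
      show "AE x in L. (\<lambda>n. max 0 (1 - real n * infdist x F)) \<longlonglongrightarrow> indicator F x"
      proof (intro AE_I2)
        fix x
        show "(\<lambda>n. max 0 (1 - real n * infdist x F)) \<longlonglongrightarrow> indicator F x"
        proof (cases "x \<in> F")
          case False
          then have d: "infdist x F > 0"
            using in_closed_iff_infdist_zero[OF F] infdist_nonneg[of x F] by force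
          obtain n0 :: nat where n0: "1 / infdist x F < real n0" using reals_Archimedean2 by blast
          have "max 0 (1 - real n * infdist x F) = 0" if "n \<ge> n0" for n
          proof -
            have "1 / infdist x F < real n" using n0 that by simp
            then show ?thesis using d by (simp add: field_simps)
          qed
          then show ?thesis
            using False by (auto intro!: tendsto_eventually eventually_sequentiallyI[of n0])
        qed simp
      qed
    qed simp
    also have "(\<integral>x. indicator F x \<partial>L) = measure L F"
      using F L(2) by simp
    finally show ?thesis .
  qed
  have closed_eq: "emeasure M F = emeasure N F" if F: "closed F" for F
  \<comment> \<open>\<open>infdist\<close> to the empty set is 0, so the approximating functions
    would be constantly 1 there.\<close>
  proof (cases "F = {}")
    case False
    have *: "(\<integral>x. max 0 (1 - real n * infdist x F) \<partial>M) = (\<integral>x. max 0 (1 - real n * infdist x F) \<partial>N)" for n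
      by (rule eq) (auto intro!: continuous_intros simp: infdist_nonneg)
    have "measure M F = measure N F"
      using LIMSEQ_unique lim[OF F False M sM] lim[OF F False N sN] unfolding * by blast
    then show ?thesis by (simp add: M.emeasure_eq_measure N.emeasure_eq_measure)
  qed simp
  show ?thesis
  proof (rule measure_eqI_generator_eq[where E = "Collect closed" and \<Omega> = UNIV and A = "\<lambda>_. UNIV"])
    show "Int_stable (Collect closed)" by (auto simp: Int_stable_def)
    show "sets M = sigma_sets UNIV (Collect closed)" "sets N = sigma_sets UNIV (Collect closed)"
      using sM sN by (simp_all add: borel_eq_closed)
  qed (use closed_eq in \<open>auto simp: M.emeasure_eq_measure\<close>)
qed

section \<open>Iterated costs\<close>

lemma sum_lessThan_add: "(\<Sum>i<m + n. f i) = (\<Sum>i<m. f i) + (\<Sum>i<n. f (m + i))"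
  for f :: "nat \<Rightarrow> 'b::comm_monoid_add"
  by (induction n) (auto simp: add.assoc)

text \<open>A one-sided bound suffices because it may be used with the two points exchanged. In this
  form it passes directly to infima and lower limits over \<open>n\<close>.\<close>

lemma continuous_on_UNIV_if_equicontinuous_le:
  fixes F :: "'a::metric_space \<Rightarrow> 'b::metric_space \<Rightarrow> real"
  assumes "\<And>e. e > 0 \<Longrightarrow> \<exists>d>0. \<forall>x x' y y'. dist x x' < d \<longrightarrow> dist y y' < d \<longrightarrow> F x' y' \<le> F x y + e"
  shows "continuous_on UNIV (\<lambda>p. F (fst p) (snd p))"
  unfolding continuous_on_iff
proof (intro ballI allI impI)
  fix p :: "'a \<times> 'b" and e :: real assume "e > 0"
  then obtain d where d: "d > 0"
    "\<And>x x' y y'. dist x x' < d \<Longrightarrow> dist y y' < d \<Longrightarrow> F x' y' \<le> F x y + e / 2"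
    using assms[of "e / 2"] by auto
  have "dist (F (fst q) (snd q)) (F (fst p) (snd p)) < e" if "dist q p < d" for q
  proof -
    have "dist (fst q) (fst p) < d" "dist (snd q) (snd p) < d"
      using dist_fst_le[of q p] dist_snd_le[of q p] that by auto
    then have "F (fst p) (snd p) \<le> F (fst q) (snd q) + e / 2" "F (fst q) (snd q) \<le> F (fst p) (snd p) + e / 2"
      by (auto intro!: d(2) simp: dist_commute)
    then show ?thesis using \<open>e > 0\<close> by (simp add: dist_real_def abs_less_iff)
  qed
  then show "\<exists>d>0. \<forall>q\<in>UNIV. dist q p < d \<longrightarrow> dist (F (fst q) (snd q)) (F (fst p) (snd p)) < e"
    using d(1) by blast
qed

section \<open>Subadditivity, equicontinuity and linear growth of the iterated costs\<close>

locale compact_cost =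
  fixes A :: "'a::metric_space \<times> 'a \<Rightarrow> real"
  assumes compact: "compact (UNIV :: 'a set)"
    and cont: "continuous_on UNIV A"
begin

lemma compact_prod: "compact (UNIV :: ('a \<times> 'a) set)"
  using compact_Times[OF compact compact] by simp

lemma A_bounded: obtains B where "B > 0" "\<And>p. \<bar>A p\<bar> \<le> B"
proof -
  have "bounded (range A)"
    using compact_imp_bounded[OF compact_continuous_image[OF cont compact_prod]] .
  then show thesis using that unfolding bounded_pos by auto
qed

lemma iter_cost_le_path:
  assumes "z 0 = x" "z n = y"
  shows "iter_cost A n x y \<le> (\<Sum>i<n. A (z i, z (Suc i)))"
proof -
  obtain B where B: "\<And>p. \<bar>A p\<bar> \<le> B" using A_bounded by metis
  have "bdd_below ((\<lambda>z. \<Sum>i<n. A (z i, z (Suc i))) ` {z. z 0 = x \<and> z n = y})"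
  proof (intro bdd_belowI2)
    fix z :: "nat \<Rightarrow> 'a"
    show "(\<Sum>i<n. - B) \<le> (\<Sum>i<n. A (z i, z (Suc i)))"
      by (intro sum_mono) (metis B abs_le_D2 minus_le_iff)
  qed
  then show ?thesis unfolding iter_cost_def using assms by (intro cINF_lower) simp_all
qed

text \<open>Serves in place of an attained minimum. Positive length guarantees that some path joins
  \<open>x\<close> to \<open>y\<close>, for instance the one jumping to \<open>y\<close> at
  once.\<close>

lemma near_optimal_path:
  assumes "n > 0" "e > 0"
  obtains z where "z 0 = x" "z n = y" "(\<Sum>i<n. A (z i, z (Suc i))) < iter_cost A n x y + e"
proof -
  have "(\<lambda>i. if i = 0 then x else y) \<in> {z. z 0 = x \<and> z n = y}" using assms by simp
  then have "{z. z 0 = x \<and> z n = y} \<noteq> {}" by (metis empty_iff)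
  then have "(\<lambda>z. \<Sum>i<n. A (z i, z (Suc i))) ` {z. z 0 = x \<and> z n = y} \<noteq> {}" by simp
  moreover have "(INF z\<in>{z. z 0 = x \<and> z n = y}. \<Sum>i<n. A (z i, z (Suc i))) < iter_cost A n x y + e"
    unfolding iter_cost_def using assms(2) by simp
  ultimately obtain v where "v \<in> (\<lambda>z. \<Sum>i<n. A (z i, z (Suc i))) ` {z. z 0 = x \<and> z n = y}"
    "v < iter_cost A n x y + e"
    by (rule cInf_lessD[THEN bexE])
  then show thesis using that by blast
qed

lemma iter_cost_1_le: "iter_cost A 1 x y \<le> A (x, y)"
  by (rule order_trans[OF iter_cost_le_path[of "\<lambda>i. if i = 0 then x else y"]]) simp_all

lemma iter_cost_concat:
  assumes "m > 0" "n > 0"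
  shows "iter_cost A (m + n) x w \<le> iter_cost A m x y + iter_cost A n y w"
proof (rule field_le_epsilon)
  fix e :: real assume "e > 0"
  then have e: "e / 2 > 0" by simp
  obtain z1 where z1: "z1 0 = x" "z1 m = y" "(\<Sum>i<m. A (z1 i, z1 (Suc i))) < iter_cost A m x y + e/2"
    using near_optimal_path[OF assms(1) e] by metis
  obtain z2 where z2: "z2 0 = y" "z2 n = w" "(\<Sum>i<n. A (z2 i, z2 (Suc i))) < iter_cost A n y w + e/2"
    using near_optimal_path[OF assms(2) e] by metis
  \<comment> \<open>The two paths are glued at time \<open>m\<close>, where both are at
    \<open>y\<close>.\<close>
  define z where "z i = (if i \<le> m then z1 i else z2 (i - m))" for i
  have "z (m + i) = z2 i" for i using z1 z2 by (cases i) (auto simp: z_def)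
  then have "(\<Sum>i<m + n. A (z i, z (Suc i))) = (\<Sum>i<m. A (z1 i, z1 (Suc i))) + (\<Sum>i<n. A (z2 i, z2 (Suc i)))"
    unfolding sum_lessThan_add by (simp add: z_def flip: add_Suc_right)
  moreover have "iter_cost A (m + n) x w \<le> (\<Sum>i<m + n. A (z i, z (Suc i)))"
    by (rule iter_cost_le_path) (use z1 z2 assms in \<open>auto simp: z_def\<close>)
  ultimately show "iter_cost A (m + n) x w \<le> iter_cost A m x y + iter_cost A n y w + e"
    using z1 z2 by simp
qed

lemma iter_cost_mult:
  assumes "m > 0" "n > 0"
  shows "iter_cost A (m * n) x x \<le> real m * iter_cost A n x x"
  using assms(1)
proof (induction m rule: nat_induct_non_zero)
  case (Suc m)
  then show ?case
    using iter_cost_concat[of n "m * n" x x x] assms(2) by (simp add: algebra_simps)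
qed simp

text \<open>Moving the endpoints of a path changes only its first and last step, so the error does
  not depend on \<open>n\<close>.\<close>

lemma iter_cost_perturb:
  assumes n: "n > 0" and x: "\<And>w. A (x', w) \<le> A (x, w) + e" and y: "\<And>w. A (w, y') \<le> A (w, y) + e"
  shows "iter_cost A n x' y' \<le> iter_cost A n x y + 2 * e"
proof (rule field_le_epsilon)
  fix d :: real assume d: "d > 0"
  obtain k where k: "n = Suc k" using n gr0_conv_Suc by auto
  obtain z where z: "z 0 = x" "z n = y" "(\<Sum>i<n. A (z i, z (Suc i))) < iter_cost A n x y + d"
    using near_optimal_path[OF n d] by metis
  \<comment> \<open>The ends are moved one after the other, so that \<open>n = 1\<close>, where
    first and last step coincide, is covered too.\<close>
  define z' where "z' = z(0 := x')"
  have "(\<Sum>i<n. A (z' i, z' (Suc i))) = A (x', z 1) + (\<Sum>i<k. A (z (Suc i), z (Suc (Suc i))))"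
    unfolding k sum.lessThan_Suc_shift by (simp add: z'_def)
  moreover have "(\<Sum>i<n. A (z i, z (Suc i))) = A (x, z 1) + (\<Sum>i<k. A (z (Suc i), z (Suc (Suc i))))"
    unfolding k sum.lessThan_Suc_shift using z by simp
  ultimately have 1: "(\<Sum>i<n. A (z' i, z' (Suc i))) \<le> (\<Sum>i<n. A (z i, z (Suc i))) + e"
    using x[of "z 1"] by simp
  define z'' where "z'' = z'(n := y')"
  have "(\<Sum>i<n. A (z'' i, z'' (Suc i))) = (\<Sum>i<k. A (z' i, z' (Suc i))) + A (z' k, y')"
    unfolding k sum.lessThan_Suc by (simp add: z''_def k)
  moreover have "z' n = y" using z by (simp add: z'_def k)
  then have "(\<Sum>i<n. A (z' i, z' (Suc i))) = (\<Sum>i<k. A (z' i, z' (Suc i))) + A (z' k, y)"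
    unfolding k sum.lessThan_Suc by simp
  ultimately have 2: "(\<Sum>i<n. A (z'' i, z'' (Suc i))) \<le> (\<Sum>i<n. A (z' i, z' (Suc i))) + e"
    using y[of "z' k"] by simp
  have "iter_cost A n x' y' \<le> (\<Sum>i<n. A (z'' i, z'' (Suc i)))"
    by (rule iter_cost_le_path) (simp_all add: z''_def z'_def k)
  then show "iter_cost A n x' y' \<le> iter_cost A n x y + 2 * e + d"
    using 1 2 z by linarith
qed

lemma iter_cost_equicontinuous:
  assumes "e > 0"
  obtains d where "d > 0"
    "\<And>n x x' y y'. n > 0 \<Longrightarrow> dist x x' < d \<Longrightarrow> dist y y' < d \<Longrightarrow> iter_cost A n x' y' \<le> iter_cost A n x y + e"
proof -
  have "uniformly_continuous_on UNIV A"
    by (rule compact_uniformly_continuous[OF cont compact_prod])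
  then obtain d where d: "d > 0" "\<And>p q. dist p q < d \<Longrightarrow> dist (A p) (A q) < e / 2"
    unfolding uniformly_continuous_on_def using assms by (metis UNIV_I half_gt_zero)
  have *: "A q \<le> A p + e / 2" if "dist p q < d" for p q
    using d(2)[OF that] unfolding dist_real_def by linarith
  show thesis
  proof (rule that[OF d(1)])
    fix n :: nat and x x' y y' :: 'a
    assume "n > 0" "dist x x' < d" "dist y y' < d"
    then have "iter_cost A n x' y' \<le> iter_cost A n x y + 2 * (e / 2)"
      by (intro iter_cost_perturb *) (auto simp: dist_prod_def)
    then show "iter_cost A n x' y' \<le> iter_cost A n x y + e" by simp
  qed
qed

text \<open>A two-sided Fekete argument: the loop costs \<open>b\<close> are subadditive by
  concatenation, and superadditive up to a constant because a loop can be cut and both pieces closed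
  up at bounded cost.\<close>

lemma iter_cost_linear_growth:
  "\<exists>l. \<exists>C>0. \<forall>n\<ge>1. \<forall>x y. \<bar>iter_cost A n x y - l * real n\<bar> \<le> C"
proof -
  obtain B where B: "B > 0" "\<And>p. \<bar>A p\<bar> \<le> B" using A_bounded by metis
  \<comment> \<open>Values of \<open>A\<close> differ by at most \<open>2 * B\<close>, and two ends
    are moved.\<close>
  have osc: "iter_cost A n x' y' \<le> iter_cost A n x y + 4 * B" if "n > 0" for n x y x' y'
  proof -
    have "A p \<le> A q + 2 * B" for p q using B(2)[of p] B(2)[of q] by (simp add: abs_le_iff)
    then show ?thesis using iter_cost_perturb[OF that, of x' x "2 * B" y' y] by simp
  qed
  define x0 :: 'a where "x0 = undefined"
  define b where "b n = iter_cost A n x0 x0" for n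
  \<comment> \<open>Cut a near-optimal loop at time \<open>m\<close>; turning each of the two pieces
    into a loop at \<open>x0\<close> costs at most \<open>4 * B\<close>.\<close>
  have super: "b m + b n \<le> b (m + n) + 8 * B" if mn: "m > 0" "n > 0" for m n
  proof (rule field_le_epsilon)
    fix e :: real assume e: "e > 0"
    obtain z where z: "z 0 = x0" "z (m + n) = x0" "(\<Sum>i<m + n. A (z i, z (Suc i))) < b (m + n) + e"
      using near_optimal_path[of "m + n" e x0 x0] mn e unfolding b_def by auto
    have "iter_cost A m x0 (z m) \<le> (\<Sum>i<m. A (z i, z (Suc i)))"
      by (rule iter_cost_le_path) (use z in auto)
    moreover have "iter_cost A n (z m) x0 \<le> (\<Sum>i<n. A (z (m + i), z (m + Suc i)))"
      by (rule iter_cost_le_path) (use z in auto)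
    moreover have "b m \<le> iter_cost A m x0 (z m) + 4 * B" "b n \<le> iter_cost A n (z m) x0 + 4 * B"
      unfolding b_def by (auto intro!: osc mn)
    ultimately show "b m + b n \<le> b (m + n) + 8 * B + e"
      using z(3) unfolding sum_lessThan_add by simp
  qed
  have super_mult: "real k * (b n - 8 * B) \<le> b (k * n) - 8 * B" if "k > 0" "n > 0" for k n
    using that(1)
  proof (induction k rule: nat_induct_non_zero)
    case (Suc k)
    then show ?case using super[of n "k * n"] that(2) by (simp add: algebra_simps)
  qed simp
  have sub_mult: "b (k * n) \<le> real k * b n" if "k > 0" "n > 0" for k n
    unfolding b_def using iter_cost_mult that by blast
  \<comment> \<open>Compare through \<open>b (m * n)\<close>: \<open>m\<close> blocks of length
    \<open>n\<close> bound it from below, \<open>n\<close> blocks of length \<open>m\<close> from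
    above.\<close>
  have cross: "(b n - 8 * B) / real n \<le> b m / real m" if "m > 0" "n > 0" for m n
  proof -
    have "real m * (b n - 8 * B) \<le> real n * b m"
      using super_mult[OF that] sub_mult[OF that(2,1)] B(1) by (simp add: mult.commute)
    then show ?thesis using that by (simp add: field_simps)
  qed
  define l where "l = (INF n\<in>{1..}. b n / real n)"
  have bdd: "bdd_below ((\<lambda>n. b n / real n) ` {1..})"
    using cross[of _ 1] by (intro bdd_belowI2[of _ "b 1 - 8 * B"]) auto
  have l: "l * real n \<le> b n" "b n - 8 * B \<le> l * real n" if "n > 0" for n
  proof -
    have "l \<le> b n / real n" unfolding l_def using that by (intro cINF_lower bdd) auto
    then show "l * real n \<le> b n" using that by (simp add: field_simps)
    have "(b n - 8 * B) / real n \<le> l" unfolding l_def using that cross by (intro cINF_greatest) auto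
    then show "b n - 8 * B \<le> l * real n" using that by (simp add: field_simps)
  qed
  have "\<bar>iter_cost A n x y - l * real n\<bar> \<le> 12 * B" if "n \<ge> 1" for n x y
    using osc[of n x y x0 x0] osc[of n x0 x0 x y] l[of n] that B(1) by (simp add: b_def abs_le_iff)
  then show ?thesis using B(1) by (intro exI[of _ l] exI[of _ "12 * B"]) auto
qed

text \<open>Justifies the definite description: for two distinct rates, \<open>n * (l - l')\<close>
  would have to stay bounded.\<close>

lemma iter_cost_growth_rate:
  "\<exists>C>0. \<forall>n\<ge>1. \<forall>x y. \<bar>iter_cost A n x y - growth_rate A * real n\<bar> \<le> C"
  unfolding growth_rate_def
proof (rule theI')
  let ?P = "\<lambda>l. \<exists>C>0. \<forall>n\<ge>1. \<forall>x y. \<bar>iter_cost A n x y - l * real n\<bar> \<le> C"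
  have "l \<le> l'" if P: "?P l" "?P l'" for l l'
  proof (rule ccontr)
    assume "\<not> l \<le> l'"
    then have pos: "l - l' > 0" by simp
    obtain C C' where C: "\<And>n x y. n \<ge> 1 \<Longrightarrow> \<bar>iter_cost A n x y - l * real n\<bar> \<le> C"
      and C': "\<And>n x y. n \<ge> 1 \<Longrightarrow> \<bar>iter_cost A n x y - l' * real n\<bar> \<le> C'"
      using P by metis
    obtain n where n: "C + C' < real n * (l - l')" using reals_Archimedean3[OF pos] by blast
    \<comment> \<open>Nonnegativity excludes \<open>n = 0\<close>, where the growth bounds say
      nothing.\<close>
    have "C \<ge> 0" "C' \<ge> 0" using C[of 1] C'[of 1] abs_ge_zero order_trans by blast+
    then have "n \<ge> 1" using n by (cases n) auto
    then have "real n * (l - l') \<le> C + C'"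
      using C[of n undefined undefined] C'[of n undefined undefined] by (simp add: algebra_simps abs_le_iff)
    then show False using n by simp
  qed
  then show "\<exists>!l. ?P l" using iter_cost_linear_growth by (metis (no_types, lifting) order_antisym)
qed

end

section \<open>Growth rate zero: the function \<open>c\<close>\<close>

locale critical_cost = compact_cost +
  assumes growth_rate_0: "growth_rate A = 0"
begin

lemma iter_cost_bounded: obtains C where "C > 0" "\<And>n x y. n > 0 \<Longrightarrow> \<bar>iter_cost A n x y\<bar> \<le> C"
proof -
  obtain C where "C > 0" "\<And>n x y. n \<ge> 1 \<Longrightarrow> \<bar>iter_cost A n x y - growth_rate A * real n\<bar> \<le> C"
    using iter_cost_growth_rate by blast
  then show thesis using that[of C] by (simp add: growth_rate_0)
qed

text \<open>The real version of the lower limit; by \<open>liminf_cost_eq\<close> no infinite value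
  is collapsed to 0 here.\<close>

definition c :: "'a \<Rightarrow> 'a \<Rightarrow> real" where
  "c x y = real_of_ereal (liminf_cost A x y)"

lemma liminf_cost_eq: "liminf_cost A x y = ereal (c x y)"
proof -
  obtain C where C: "C > 0" "\<And>n x y. n > 0 \<Longrightarrow> \<bar>iter_cost A n x y\<bar> \<le> C"
    using iter_cost_bounded by metis
  have "- C \<le> iter_cost A n x y" "iter_cost A n x y \<le> C" if "n \<ge> 1" for n
    using C(2)[of n x y] that by linarith+
  note bounds = this
  have "ereal (- C) \<le> liminf_cost A x y"
    unfolding liminf_cost_def
    by (intro Liminf_bounded eventually_sequentiallyI[of 1]) (use bounds in auto)
  moreover have "liminf_cost A x y \<le> limsup (\<lambda>n. ereal (iter_cost A n x y))"
    unfolding liminf_cost_def by (intro Liminf_le_Limsup) simp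
  moreover have "\<dots> \<le> ereal C"
    by (intro Limsup_bounded eventually_sequentiallyI[of 1]) (use bounds in auto)
  ultimately have "\<bar>liminf_cost A x y\<bar> \<noteq> \<infinity>" by auto
  then show ?thesis unfolding c_def by (simp add: ereal_real')
qed

lemma eventually_less_iter_cost:
  assumes "v < c x y" shows "\<forall>\<^sub>F n in sequentially. v < iter_cost A n x y"
proof -
  have "ereal v < liminf (\<lambda>n. ereal (iter_cost A n x y))"
    using assms liminf_cost_eq[of x y] by (simp add: liminf_cost_def)
  from less_LiminfD[OF this] show ?thesis by simp
qed

lemma le_c_if_eventually_le:
  assumes "\<forall>\<^sub>F n in sequentially. v \<le> iter_cost A n x y" shows "v \<le> c x y"
proof -
  have "ereal v \<le> liminf (\<lambda>n. ereal (iter_cost A n x y))"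
    using assms by (intro Liminf_bounded) simp
  then show ?thesis using liminf_cost_eq[of x y] by (simp add: liminf_cost_def)
qed

text \<open>Shifting the index by a fixed \<open>k\<close> leaves a lower limit unchanged. The shift
  is the length of an attached path below, and 0 for the continuity of \<open>c\<close>.\<close>

lemma c_le_add_if_shift_le:
  assumes le: "\<And>n. n > 0 \<Longrightarrow> iter_cost A (n + k) x y \<le> v + iter_cost A n x' y'"
  shows "c x y \<le> v + c x' y'"
proof (rule field_le_epsilon)
  fix e :: real assume "e > 0"
  then have "\<forall>\<^sub>F n in sequentially. c x y - e < iter_cost A n x y"
    by (intro eventually_less_iter_cost) simp
  then have "\<forall>\<^sub>F n in sequentially. c x y - e < iter_cost A (n + k) x y"
    by (rule sequentially_offset)
  then have "\<forall>\<^sub>F n in sequentially. c x y - e - v \<le> iter_cost A n x' y'"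
    using eventually_gt_at_top[of 0]
  proof eventually_elim
    case (elim n)
    then show ?case using le[of n] by simp
  qed
  from le_c_if_eventually_le[OF this] show "c x y \<le> v + c x' y' + e" by simp
qed

lemma c_le_iter_cost_add: "n > 0 \<Longrightarrow> c x w \<le> iter_cost A n x y + c y w"
proof (rule c_le_add_if_shift_le)
  fix k :: nat assume "n > 0" "k > 0"
  then show "iter_cost A (k + n) x w \<le> iter_cost A n x y + iter_cost A k y w"
    using iter_cost_concat[of n k x w y] by (simp add: add.commute)
qed

lemma c_le_add_iter_cost: "n > 0 \<Longrightarrow> c x w \<le> iter_cost A n y w + c x y"
proof (rule c_le_add_if_shift_le)
  fix k :: nat assume "n > 0" "k > 0"
  then show "iter_cost A (k + n) x w \<le> iter_cost A n y w + iter_cost A k x y"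
    using iter_cost_concat[of k n x w y] by simp
qed

lemma c_le_cost_add: "c x w \<le> A (x, y) + c y w"
  using c_le_iter_cost_add[of 1 x w y] iter_cost_1_le[of x y] by simp

lemma c_le_add_cost: "c x w \<le> c x y + A (y, w)"
  using c_le_add_iter_cost[of 1 x w y] iter_cost_1_le[of y w] by simp

text \<open>\<open>c_le_iter_cost_add\<close> holds for every length of the first leg, so the lower
  limit over that length can be taken.\<close>

lemma c_triangle: "c x w \<le> c x y + c y w"
proof -
  have "c x w - c y w \<le> c x y"
  proof (intro le_c_if_eventually_le eventually_sequentiallyI[of 1])
    fix n :: nat assume "n \<ge> 1"
    then show "c x w - c y w \<le> iter_cost A n x y" using c_le_iter_cost_add[of n x w y] by simp
  qed
  then show ?thesis by simp
qed

lemma c_self_nonneg: "0 \<le> c x x"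
  using c_triangle[of x x x] by simp

lemma mem_calibrated_set: "(x, y) \<in> calibrated_set A \<longleftrightarrow> A (x, y) + c y x = 0"
  by (simp add: calibrated_set_def liminf_cost_eq zero_ereal_def)

lemma c_continuous: "continuous_on UNIV (\<lambda>p. c (fst p) (snd p))"
proof (rule continuous_on_UNIV_if_equicontinuous_le)
  fix e :: real assume "e > 0"
  then obtain d where d: "d > 0"
    "\<And>n x x' y y'. n > 0 \<Longrightarrow> dist x x' < d \<Longrightarrow> dist y y' < d \<Longrightarrow> iter_cost A n x' y' \<le> iter_cost A n x y + e"
    using iter_cost_equicontinuous by metis
  have "c x' y' \<le> c x y + e" if "dist x x' < d" "dist y y' < d" for x x' y y'
    using c_le_add_if_shift_le[of 0 x' y' e x y] d(2)[OF _ that] by (simp add: add.commute)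
  then show "\<exists>d>0. \<forall>x x' y y'. dist x x' < d \<longrightarrow> dist y y' < d \<longrightarrow> c x' y' \<le> c x y + e"
    using d(1) by blast
qed

section \<open>The Mane potential and closed paths of small cost\<close>

definition mane_potential :: "'a \<Rightarrow> 'a \<Rightarrow> real" where
  "mane_potential x y = (INF n\<in>{1..}. iter_cost A n x y)"

lemma mane_potential_le: "n > 0 \<Longrightarrow> mane_potential x y \<le> iter_cost A n x y"
proof -
  obtain C where "\<And>n x y. n > 0 \<Longrightarrow> \<bar>iter_cost A n x y\<bar> \<le> C"
    using iter_cost_bounded by metis
  then have "bdd_below ((\<lambda>n. iter_cost A n x y) ` {1..})"
    by (intro bdd_belowI2[of _ "- C"]) (metis abs_le_D2 atLeast_iff less_eq_Suc_le minus_le_iff One_nat_def)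
  then show "n > 0 \<Longrightarrow> mane_potential x y \<le> iter_cost A n x y"
    unfolding mane_potential_def by (intro cINF_lower) simp_all
qed

lemma mane_potential_greatest: "(\<And>n. n > 0 \<Longrightarrow> v \<le> iter_cost A n x y) \<Longrightarrow> v \<le> mane_potential x y"
  unfolding mane_potential_def by (rule cINF_greatest) simp_all

lemma mane_potential_le_cost: "mane_potential x y \<le> A (x, y)"
  using mane_potential_le[of 1 x y] iter_cost_1_le[of x y] by simp

lemma mane_potential_le_add_cost: "mane_potential x w \<le> mane_potential x y + A (y, w)"
proof -
  have "mane_potential x w - A (y, w) \<le> iter_cost A n x y" if "n > 0" for n
    using iter_cost_concat[OF that, of 1 x w y] iter_cost_1_le[of y w] mane_potential_le[of "n + 1" x w]
    by simp
  then show ?thesis using mane_potential_greatest[of "mane_potential x w - A (y, w)" x y] by simp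
qed

lemma mane_potential_continuous: "continuous_on UNIV (\<lambda>p. mane_potential (fst p) (snd p))"
proof (rule continuous_on_UNIV_if_equicontinuous_le)
  fix e :: real assume "e > 0"
  then obtain d where d: "d > 0"
    "\<And>n x x' y y'. n > 0 \<Longrightarrow> dist x x' < d \<Longrightarrow> dist y y' < d \<Longrightarrow> iter_cost A n x' y' \<le> iter_cost A n x y + e"
    using iter_cost_equicontinuous by metis
  have "mane_potential x' y' \<le> mane_potential x y + e" if "dist x x' < d" "dist y y' < d" for x x' y y'
  proof -
    have "mane_potential x' y' - e \<le> iter_cost A n x y" if "n > 0" for n
      using mane_potential_le[OF that, of x' y'] d(2)[OF that \<open>dist x x' < d\<close> \<open>dist y y' < d\<close>] by simp
    then show ?thesis using mane_potential_greatest[of "mane_potential x' y' - e" x y] by simp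
  qed
  then show "\<exists>d>0. \<forall>x x' y y'. dist x x' < d \<longrightarrow> dist y y' < d \<longrightarrow> mane_potential x' y' \<le> mane_potential x y + e"
    using d(1) by blast
qed

text \<open>If \<open>c x x\<close> were positive, all long loops at \<open>x\<close> would cost
  more than \<open>v\<close>, half of it. But loops of arbitrarily small cost exist, and repeating
  one of them makes it long while keeping its cost below \<open>v\<close>.\<close>

lemma c_self_eq_0:
  assumes "mane_potential x x \<le> 0" shows "c x x = 0"
proof (rule antisym[OF _ c_self_nonneg], rule ccontr)
  assume "\<not> c x x \<le> 0"
  define v where "v = c x x / 2"
  have v: "v > 0" "v < c x x" using \<open>\<not> c x x \<le> 0\<close> by (auto simp: v_def)
  obtain N where N: "\<And>n. n \<ge> N \<Longrightarrow> v < iter_cost A n x x"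
    using eventually_less_iter_cost[OF v(2)] unfolding eventually_sequentially by blast
  \<comment> \<open>A cost this small allows \<open>Suc N\<close> repetitions, which give length at
    least \<open>N\<close> whatever the loop.\<close>
  have "\<exists>n>0. iter_cost A n x x < v / real (Suc N)"
  proof (rule ccontr)
    assume "\<not> ?thesis"
    then have "v / real (Suc N) \<le> mane_potential x x" by (intro mane_potential_greatest) (meson not_less)
    moreover have "v / real (Suc N) > 0" using v(1) by simp
    ultimately show False using assms by linarith
  qed
  then obtain n where n: "n > 0" "iter_cost A n x x < v / real (Suc N)" by blast
  have "iter_cost A (Suc N * n) x x \<le> real (Suc N) * iter_cost A n x x"
    by (rule iter_cost_mult) (use n(1) in simp_all)
  also have "\<dots> < v" using n(2) by (simp add: field_simps)
  finally show False using N[of "Suc N * n"] n(1) by (cases n) auto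
qed

end

section \<open>Measures with equal marginals\<close>

lemma integrable_continuous_compact_space:
  fixes f :: "'a::metric_space \<Rightarrow> real"
  assumes X: "compact (UNIV :: 'a set)" and M: "finite_measure M" "sets M = sets borel"
    and f: "continuous_on UNIV f"
  shows "integrable M f"
proof -
  interpret finite_measure M by (rule M)
  obtain C where "\<And>x. norm (f x) \<le> C"
    using compact_imp_bounded[OF compact_continuous_image[OF f X]] unfolding bounded_iff by auto
  moreover have "f \<in> borel_measurable M"
    using borel_measurable_continuous_onI[OF f] measurable_cong_sets[OF M(2) refl] by blast
  ultimately show ?thesis by (intro integrable_const_bound[of _ C]) auto
qed

text \<open>The set where a continuous \<open>f\<close> is nonzero is open, so if null it misses the
  support. Conversely, each set where the absolute value of \<open>f\<close> is at least 1/(n+1) is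
  compact and avoids the support, hence is covered by finitely many null open sets.\<close>

lemma AE_eq_0_iff_on_support:
  fixes f :: "'a::metric_space \<Rightarrow> real"
  assumes X: "compact (UNIV :: 'a set)" and M: "sets M = sets borel" and f: "continuous_on UNIV f"
  shows "(AE x in M. f x = 0) \<longleftrightarrow> (\<forall>x\<in>measure_support M. f x = 0)"
proof
  have open_null: "(AE x in M. x \<notin> U) \<longleftrightarrow> emeasure M U = 0" if "open U" for U
    using that M by (intro AE_iff_null_sets[symmetric, THEN trans]) (auto simp: null_sets_def)
  assume ae: "AE x in M. f x = 0"
  show "\<forall>x\<in>measure_support M. f x = 0"
  proof (intro ballI, rule ccontr)
    fix x assume x: "x \<in> measure_support M" "f x \<noteq> 0"
    let ?U = "{x. f x \<noteq> 0}"
    have U: "open ?U" using f by (intro open_Collect_neq) auto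
    have "AE x in M. x \<notin> ?U" using ae by eventually_elim simp
    then have "emeasure M ?U = 0" using open_null[OF U] by simp
    moreover have "emeasure M ?U > 0" using x U unfolding measure_support_def by blast
    ultimately show False by simp
  qed
next
  assume supp: "\<forall>x\<in>measure_support M. f x = 0"
  have "AE x in M. \<not> 1 / real (Suc n) \<le> \<bar>f x\<bar>" for n
  proof -
    let ?C = "{x. 1 / real (Suc n) \<le> \<bar>f x\<bar>}"
    have "closed ?C" using f by (intro closed_Collect_le continuous_intros)
    then have C: "compact ?C" using compact_Int_closed[OF X] by simp
    have "\<exists>U. open U \<and> x \<in> U \<and> emeasure M U = 0" if "x \<in> ?C" for x
    proof -
      have "f x \<noteq> 0" using that by auto
      then have "x \<notin> measure_support M" using supp by blast
      then show ?thesis unfolding measure_support_def by (auto simp: not_gr_zero)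
    qed
    then have "?C \<subseteq> \<Union>{U. open U \<and> emeasure M U = 0}" by blast
    then obtain D where D: "D \<subseteq> {U. open U \<and> emeasure M U = 0}" "finite D" "?C \<subseteq> \<Union>D"
      using compactE[OF C, of "{U. open U \<and> emeasure M U = 0}"] by blast
    have "U \<in> null_sets M" if "U \<in> D" for U
      using D(1) that M by (auto simp: null_sets_def)
    then have "\<Union>D \<in> null_sets M"
      using D(2) by (intro null_sets.finite_Union) auto
    then show ?thesis by (rule AE_I') (use D(3) in auto)
  qed
  then have "AE x in M. \<forall>n. \<not> 1 / real (Suc n) \<le> \<bar>f x\<bar>" by (simp add: AE_all_countable)
  then show "AE x in M. f x = 0"
  proof eventually_elim
    case (elim x)
    show ?case
    proof (rule ccontr)
      assume "f x \<noteq> 0"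
      then obtain n where "inverse (real (Suc n)) < \<bar>f x\<bar>" using reals_Archimedean[of "\<bar>f x\<bar>"] by auto
      then show False using elim by (auto simp: inverse_eq_divide dest!: spec[of _ n])
    qed
  qed
qed

context compact_cost
begin

lemma integrable_equal_marginal:
  assumes "\<eta> \<in> equal_marginal_measures" "continuous_on UNIV f"
  shows "integrable \<eta> (f :: 'a \<times> 'a \<Rightarrow> real)"
proof -
  interpret prob_space \<eta> using assms by (simp add: equal_marginal_measures_def)
  show ?thesis
    using assms by (intro integrable_continuous_compact_space compact_prod)
      (auto simp: equal_marginal_measures_def finite_measure_axioms)
qed

text \<open>Both terms integrate to the integral of \<open>u\<close> against the common
  marginal.\<close>

lemma integral_coboundary:
  assumes \<eta>: "\<eta> \<in> equal_marginal_measures" and u: "continuous_on UNIV (u :: 'a \<Rightarrow> real)"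
  shows "(\<integral>p. u (snd p) - u (fst p) \<partial>\<eta>) = 0"
proof -
  have s: "sets \<eta> = sets borel" and d: "distr \<eta> borel fst = distr \<eta> borel snd"
    using \<eta> by (auto simp: equal_marginal_measures_def)
  have m: "fst \<in> measurable \<eta> (borel :: 'a measure)" "snd \<in> measurable \<eta> (borel :: 'a measure)"
    unfolding measurable_cong_sets[OF s refl]
    by (intro borel_measurable_continuous_onI continuous_intros)+
  have um: "u \<in> borel_measurable borel" using u by (rule borel_measurable_continuous_onI)
  have "(\<integral>p. u (fst p) \<partial>\<eta>) = (\<integral>p. u (snd p) \<partial>\<eta>)"
    using integral_distr[OF m(1) um] integral_distr[OF m(2) um] d by simp
  moreover have "integrable \<eta> (\<lambda>p. u (fst p))" "integrable \<eta> (\<lambda>p. u (snd p))"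
    by (intro integrable_equal_marginal[OF \<eta>] continuous_on_compose2[OF u] continuous_intros, simp)+
  ultimately show ?thesis by simp
qed

text \<open>Subtracting the coboundary of \<open>u\<close> does not change the integral and makes
  the integrand nonnegative; its integral then vanishes only if it is 0 almost everywhere, hence on
  the support.\<close>

lemma integral_subaction:
  assumes \<eta>: "\<eta> \<in> equal_marginal_measures" and u: "continuous_on UNIV u"
    and le: "\<And>x y. u y - u x \<le> A (x, y)"
  shows "0 \<le> (\<integral>p. A p \<partial>\<eta>)"
    and "(\<integral>p. A p \<partial>\<eta>) = 0 \<longleftrightarrow> (\<forall>(x, y)\<in>measure_support \<eta>. A (x, y) = u y - u x)"
proof -
  let ?f = "\<lambda>p. A p - (u (snd p) - u (fst p))"
  have cu: "continuous_on UNIV (\<lambda>p. u (snd p) - u (fst p))"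
    by (intro continuous_intros continuous_on_compose2[OF u]) auto
  have cf: "continuous_on UNIV ?f" by (intro continuous_intros cont cu)
  have nonneg: "0 \<le> ?f p" for p using le[of "snd p" "fst p"] by simp
  have eq: "(\<integral>p. ?f p \<partial>\<eta>) = (\<integral>p. A p \<partial>\<eta>)"
    using integrable_equal_marginal[OF \<eta> cont] integrable_equal_marginal[OF \<eta> cu]
      integral_coboundary[OF \<eta> u] by simp
  show "0 \<le> (\<integral>p. A p \<partial>\<eta>)"
    unfolding eq[symmetric] by (intro integral_nonneg_AE AE_I2 nonneg)
  have "(\<integral>p. A p \<partial>\<eta>) = 0 \<longleftrightarrow> (AE p in \<eta>. ?f p = 0)"
    unfolding eq[symmetric]
    by (intro integral_nonneg_eq_0_iff_AE integrable_equal_marginal[OF \<eta> cf] AE_I2 nonneg)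
  also have "\<dots> \<longleftrightarrow> (\<forall>p\<in>measure_support \<eta>. ?f p = 0)"
    using \<eta> by (intro AE_eq_0_iff_on_support compact_prod cf) (simp add: equal_marginal_measures_def)
  finally show "(\<integral>p. A p \<partial>\<eta>) = 0 \<longleftrightarrow> (\<forall>(x, y)\<in>measure_support \<eta>. A (x, y) = u y - u x)"
    by (auto simp: split_beta)
qed

end

section \<open>Characterization and existence of minimizing measures\<close>

context critical_cost
begin

lemma c_subaction:
  shows "continuous_on UNIV (c p)" and "c p y - c p x \<le> A (x, y)"
  using continuous_on_compose2[OF c_continuous, of UNIV "\<lambda>x. (p, x)"] c_le_add_cost[of p y x]
  by (simp_all add: continuous_on_Pair)

lemma integral_nonneg: "\<eta> \<in> equal_marginal_measures \<Longrightarrow> 0 \<le> (\<integral>p. A p \<partial>\<eta>)"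
by (rule integral_subaction(1)[OF _ c_subaction])

lemma integral_eq_0_iff:
  assumes \<eta>: "\<eta> \<in> equal_marginal_measures"
  shows "(\<integral>p. A p \<partial>\<eta>) = 0 \<longleftrightarrow> measure_support \<eta> \<subseteq> calibrated_set A"
proof
  assume 0: "(\<integral>p. A p \<partial>\<eta>) = 0"
  show "measure_support \<eta> \<subseteq> calibrated_set A"
  proof clarify
    fix x y assume xy: "(x, y) \<in> measure_support \<eta>"
    \<comment> \<open>The potential is based at the very point \<open>x\<close>: equality at
      \<open>(x, y)\<close>, with \<open>mane_potential_le_cost\<close>, gives
      \<open>mane_potential x x \<le> 0\<close>.\<close>
    have "continuous_on UNIV (mane_potential x)"
      using continuous_on_compose2[OF mane_potential_continuous, of UNIV "\<lambda>y. (x, y)"]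
      by (simp add: continuous_on_Pair)
    from integral_subaction(2)[OF \<eta> this] 0 xy
    have "A (x, y) = mane_potential x y - mane_potential x x"
      using mane_potential_le_add_cost[of x] by (auto simp: algebra_simps)
    then have "c x x = 0"
      using mane_potential_le_cost[of x y] by (intro c_self_eq_0) simp
    \<comment> \<open>A second subaction with the same base point; its equality at
      \<open>(x, y)\<close> contains the term \<open>c x x\<close>, now known to be 0.\<close>
    have "continuous_on UNIV (\<lambda>y. - c y x)"
      using continuous_on_compose2[OF c_continuous, of UNIV "\<lambda>y. (y, x)"]
      by (intro continuous_intros) (simp add: continuous_on_Pair)
    from integral_subaction(2)[OF \<eta> this] 0 xy
    have "A (x, y) = - c y x - - c x x"
      using c_le_cost_add[of _ x] by (auto simp: algebra_simps)
    then show "(x, y) \<in> calibrated_set A"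
      using \<open>c x x = 0\<close> by (simp add: mem_calibrated_set)
  qed
next
  assume supp: "measure_support \<eta> \<subseteq> calibrated_set A"
  define u where "u = c undefined"
  have u: "continuous_on UNIV u" and le: "u y - u x \<le> A (x, y)" for x y
    unfolding u_def by (rule c_subaction)+
  \<comment> \<open>The subaction inequality gives one direction; the triangle inequality through
    \<open>y\<close>, with \<open>c y x = - A (x, y)\<close>, gives the other.\<close>
  have "A (x, y) = u y - u x" if "(x, y) \<in> measure_support \<eta>" for x y
  proof -
    have "A (x, y) + c y x = 0" using supp that mem_calibrated_set by blast
    moreover have "u x \<le> u y + c y x" unfolding u_def by (rule c_triangle)
    ultimately show ?thesis using le[of y x] by linarith
  qed
  then show "(\<integral>p. A p \<partial>\<eta>) = 0"
    using integral_subaction(2)[OF \<eta> u le] by blast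
qed

text \<open>Empirical measures of the steps of near-optimal loops at a fixed point have average cost
  at most \<open>(C + 1) / (n + 1)\<close>, which tends to 0; any weak limit is minimizing.\<close>

lemma exists_minimizing_measure: "\<exists>\<eta>\<in>equal_marginal_measures. (\<integral>p. A p \<partial>\<eta>) = 0"
proof -
  obtain C where C: "\<And>n x y. n > 0 \<Longrightarrow> \<bar>iter_cost A n x y\<bar> \<le> C"
    using iter_cost_bounded by metis
  define x0 :: 'a where "x0 = undefined"
  \<comment> \<open>The slack 1 is harmless, since it is later divided by the length of the
    loop.\<close>
  have "\<exists>z. z 0 = x0 \<and> z (Suc n) = x0 \<and> (\<Sum>i<Suc n. A (z i, z (Suc i))) < iter_cost A (Suc n) x0 x0 + 1" for n
    using near_optimal_path[of "Suc n" 1 x0 x0] by (metis zero_less_Suc zero_less_one)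
  then obtain z where z: "\<And>n. z n 0 = x0" "\<And>n. z n (Suc n) = x0"
    "\<And>n. (\<Sum>i<Suc n. A (z n i, z n (Suc i))) < iter_cost A (Suc n) x0 x0 + 1"
    by metis
  have zC: "(\<Sum>i<Suc n. A (z n i, z n (Suc i))) \<le> C + 1" for n
    using z(3)[of n] C[of "Suc n" x0 x0] by linarith
  obtain r \<mu> where r: "strict_mono (r :: nat \<Rightarrow> nat)" and \<mu>: "prob_space \<mu>" "sets \<mu> = sets borel"
    and lim: "\<And>f :: 'a \<times> 'a \<Rightarrow> real. continuous_on UNIV f \<Longrightarrow>
       (\<lambda>n. (\<Sum>i<Suc (r n). f (z (r n) i, z (r n) (Suc i))) / real (Suc (r n))) \<longlonglongrightarrow> integral\<^sup>L \<mu> f"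
    using empirical_measures_weakly_convergent_subseq[OF compact_prod, of Suc "\<lambda>n i. (z n i, z n (Suc i))"]
    by blast
  interpret prob_space \<mu> by (rule \<mu>)
  have m: "fst \<in> measurable \<mu> (borel :: 'a measure)" "snd \<in> measurable \<mu> (borel :: 'a measure)"
    unfolding measurable_cong_sets[OF \<mu>(2) refl]
    by (intro borel_measurable_continuous_onI continuous_intros)+
  have "distr \<mu> borel fst = distr \<mu> borel snd"
  proof (rule finite_borel_measure_eqI)
    show "finite_measure (distr \<mu> borel fst)" "finite_measure (distr \<mu> borel snd)"
      by (intro finite_measure_distr m)+
    fix f :: "'a \<Rightarrow> real" assume f: "continuous_on UNIV f"
    have fm: "f \<in> borel_measurable borel" using f by (rule borel_measurable_continuous_onI)
    \<comment> \<open>Since the path is closed, its starting points and its end points are the same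
      up to a cyclic shift, so each empirical measure already has equal marginals.\<close>
    have "(\<Sum>i<Suc n. f (z n i)) = (\<Sum>i<Suc n. f (z n (Suc i)))" for n
      using sum_lessThan_telescope[of "\<lambda>i. f (z n i)" "Suc n"] z by (simp add: sum_subtractf)
    moreover have "continuous_on UNIV (\<lambda>p. f (fst p) :: real)" "continuous_on UNIV (\<lambda>p. f (snd p) :: real)"
      by (intro continuous_on_compose2[OF f] continuous_intros, simp)+
    note lim[OF this(1)] lim[OF this(2)]
    ultimately have "(\<integral>p. f (fst p) \<partial>\<mu>) = (\<integral>p. f (snd p) \<partial>\<mu>)"
      by (auto intro: LIMSEQ_unique simp del: sum.lessThan_Suc)
    then show "integral\<^sup>L (distr \<mu> borel fst) f = integral\<^sup>L (distr \<mu> borel snd) f"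
      using integral_distr[OF m(1) fm] integral_distr[OF m(2) fm] by simp
  qed simp_all
  then have \<eta>: "\<mu> \<in> equal_marginal_measures"
    using \<mu> by (simp add: equal_marginal_measures_def)
  have "(\<lambda>n. (C + 1) / real (Suc n)) \<longlonglongrightarrow> 0"
    by (rule LIMSEQ_Suc[OF lim_const_over_n])
  then have "(\<lambda>n. (C + 1) / real (Suc (r n))) \<longlonglongrightarrow> 0"
    using LIMSEQ_subseq_LIMSEQ[OF _ r] by (force simp: o_def)
  then have "(\<integral>p. A p \<partial>\<mu>) \<le> 0"
    by (rule LIMSEQ_le[OF lim[OF cont]]) (intro exI[of _ 0] allI impI divide_right_mono zC, simp)
  then show ?thesis using \<eta> integral_nonneg[OF \<eta>] by (intro bexI[of _ \<mu>]) auto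
qed

end

theorem theorem13:
  fixes A :: "'a::metric_space \<times> 'a \<Rightarrow> real"
  assumes "compact (UNIV :: 'a set)"
    and "connected (UNIV :: 'a set)"
    and "continuous_on UNIV A"
    and "growth_rate A = 0"
  shows "(\<exists>\<eta>\<in>equal_marginal_measures. (\<integral>p. A p \<partial>\<eta>) = 0) \<and>
         (\<forall>\<eta>\<in>equal_marginal_measures. 0 \<le> (\<integral>p. A p \<partial>\<eta>)) \<and>
         (\<forall>\<eta>\<in>equal_marginal_measures.
            is_arg_min (\<lambda>\<eta>. \<integral>p. A p \<partial>\<eta>) (\<lambda>\<eta>. \<eta> \<in> equal_marginal_measures) \<eta>
            \<longleftrightarrow> measure_support \<eta> \<subseteq> calibrated_set A)"
proof -
  interpret critical_cost A
    using assms by unfold_locales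
  \<comment> \<open>The value 0 is a lower bound and is attained, so minimizing means having
    integral 0.\<close>
  have "is_arg_min (\<lambda>\<eta>. \<integral>p. A p \<partial>\<eta>) (\<lambda>\<eta>. \<eta> \<in> equal_marginal_measures) \<eta> \<longleftrightarrow> (\<integral>p. A p \<partial>\<eta>) = 0"
    if "\<eta> \<in> equal_marginal_measures" for \<eta>
    using that exists_minimizing_measure integral_nonneg
    by (metis (no_types, lifting) is_arg_min_linorder order_antisym)
  then show ?thesis
    using exists_minimizing_measure integral_nonneg integral_eq_0_iff by simp
qed

end
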